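(* Every Pisot number $\beta<1.7$ has Garsia's entropy $H_\beta>0.87$.
   Context: A Pisot number is a real algebraic integer $\beta>1$ all of whose Galois conjugates other than $\beta$ itself have modulus less than $1$. For $\beta\in(1,2)$ put $I_\beta=[0,1/(\beta-1)]$ and, for $n\ge 1$, $$D_n(\beta)=\Bigl\{x\in I_\beta: x=\sum_{k=1}^n a_k\beta^{-k}\ \text{with}\ a_k\in\{0,1\}\Bigr\},$$ $$p_n(x)=\#\Bigl\{(a_1,\dots,a_n)\in\{0,1\}^n: x=\sum_{k=1}^n a_k\beta^{-k}\Bigr\}\quad (x\in D_n(\beta)),$$ $$H_\beta^{(n)}=-\sum_{x\in D_n(\beta)}\frac{p_n(x)}{2^n}\log\frac{p_n(x)}{2^n}.$$ Garsia's entropy is $H_\beta=\lim_{n\to\infty}\dfrac{H_\beta^{(n)}}{n\log\beta}$ (the limit always exists). *)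

theory Defs
  imports "HOL-Analysis.Analysis" "HOL-Computational_Algebra.Computational_Algebra"
begin

definition is_minimal_poly :: "rat poly \<Rightarrow> complex \<Rightarrow> bool" where
  "is_minimal_poly p x \<longleftrightarrow>
     lead_coeff p = 1 \<and> irreducible p \<and> poly (map_poly of_rat p) x = 0"

definition galois_conjugate :: "complex \<Rightarrow> complex \<Rightarrow> bool" where
  "galois_conjugate x z \<longleftrightarrow>
     (\<exists>p. is_minimal_poly p x \<and> poly (map_poly of_rat p) z = 0)"

definition pisot :: "real \<Rightarrow> bool" where
  "pisot \<beta> \<longleftrightarrow> algebraic_int \<beta> \<and> \<beta> > 1 \<and>
     (\<forall>z. galois_conjugate (complex_of_real \<beta>) z \<and> z \<noteq> complex_of_real \<beta> \<longrightarrow> norm z < 1)"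

definition beta_interval :: "real \<Rightarrow> real set" where
  "beta_interval \<beta> = {0 .. 1 / (\<beta> - 1)}"

text \<open>The words of \<open>{0,1}\<^sup>n\<close> are the extensional functions on \<open>{1..n}\<close>,
  so that each word is counted exactly once by \<^const>\<open>card\<close>.\<close>

definition digit_words :: "nat \<Rightarrow> (nat \<Rightarrow> nat) set" where
  "digit_words n = {1..n} \<rightarrow>\<^sub>E {0, 1}"

definition word_value :: "real \<Rightarrow> nat \<Rightarrow> (nat \<Rightarrow> nat) \<Rightarrow> real" where
  "word_value \<beta> n a = (\<Sum>k=1..n. real (a k) / \<beta> ^ k)"

definition D_set :: "real \<Rightarrow> nat \<Rightarrow> real set" where
  "D_set \<beta> n = {x \<in> beta_interval \<beta>. \<exists>a \<in> digit_words n. x = word_value \<beta> n a}"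

definition word_count :: "real \<Rightarrow> nat \<Rightarrow> real \<Rightarrow> nat" where
  "word_count \<beta> n x = card {a \<in> digit_words n. x = word_value \<beta> n a}"

definition level_entropy :: "real \<Rightarrow> nat \<Rightarrow> real" where
  "level_entropy \<beta> n =
     - (\<Sum>x \<in> D_set \<beta> n. real (word_count \<beta> n x) / 2 ^ n * ln (real (word_count \<beta> n x) / 2 ^ n))"

definition garsia_entropy :: "real \<Rightarrow> real" where
  "garsia_entropy \<beta> = lim (\<lambda>n. level_entropy \<beta> n / (real n * ln \<beta>))"

end

theory Submission
  imports Defs
begin

text \<open>
  Garsia's entropy is the entropy per digit, in units of \<open>ln \<beta>\<close>, of the random sum
  \<open>\<Sum>k=1..n. a\<^sub>k / \<beta> ^ k\<close> with independent fair digits. It is bounded from below by the exponential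
  rate at which the probability of a collision of two independent such sums decays. Indeed Shannon
  entropy is at least the collision entropy (\<open>subset_sum_entropy_ge_collision\<close>).

  The difference of two sums, rescaled by \<open>\<beta> ^ n\<close>, is a walk \<open>x \<mapsto> \<beta> * x + \<epsilon>\<close> with \<open>\<epsilon> = -1, 0, 1\<close>
  of probabilities 1/4, 1/2, 1/4, and a collision is a return of this walk to 0. If a function
  \<open>g \<ge> 0\<close> with \<open>g 0 > 0\<close> satisfies
  \<open>g (\<beta> * x - 1) + 2 * g (\<beta> * x) + g (\<beta> * x + 1) \<le> 4 * \<rho> * g x\<close>, then the return probability is at
  most \<open>\<rho> ^ n\<close> (\<open>level_entropy_ge_supersolution\<close>). So it suffices to exhibit such a supersolution with
  \<open>\<rho> \<le> \<beta> powr (- 7 / 8)\<close>, which leaves room for the strict bound 0.87. A step function of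
  \<open>\<bar>x\<bar>\<close>, decreasing and with a few dozen steps, is good enough, and one step function serves a whole
  interval of bases. Its inequality reduces to finitely many inequalities between integers
  (\<open>certificate_supersolution\<close>), and twelve step functions cover the bases in \<open>[1.41, 2]\<close>.

  For \<open>\<beta>\<close> close to 1 the walk spreads slowly and step functions of this size would not suffice. A
  smaller base is raised to a power \<open>\<beta> ^ k\<close> in \<open>[1.41, 2]\<close>: the digits at multiples of \<open>k\<close> form an
  expansion in base \<open>\<beta> ^ k\<close>, and the other digits are independent of them and cannot decrease the
  entropy (\<open>level_entropy_power_le\<close>).

  These bounds hold at every level \<open>n\<close>. They pass to \<open>garsia_entropy\<close> because the level entropies are
  subadditive in \<open>n\<close>, so that the defining limit exists (\<open>garsia_entropy_limit\<close>).
\<close>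

section \<open>Entropy of random subset sums\<close>

text \<open>
  A word over \<open>{0, 1}\<close> is encoded by the set of positions carrying the digit 1, so that a random
  digit sum becomes \<open>sum c A\<close> with \<open>A\<close> uniformly distributed in \<open>Pow I\<close>. Cutting a word into blocks
  is then a disjoint decomposition of \<open>I\<close>, whatever the shape of the blocks.
\<close>

definition fibre_size :: "('a \<Rightarrow> real) \<Rightarrow> 'a set \<Rightarrow> real \<Rightarrow> nat" where
  "fibre_size c I y = card {A \<in> Pow I. sum c A = y}"

text \<open>
  This is the Shannon entropy of \<open>sum c A\<close>, written as the average over \<open>A\<close> (and not as a sum over
  the attained values) of \<open>- ln (fibre_size c I (sum c A) / 2 ^ card I)\<close>. In this form each
  inequality below reduces to an inequality between fibre sizes.
\<close>

definition subset_sum_entropy :: "('a \<Rightarrow> real) \<Rightarrow> 'a set \<Rightarrow> real" where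
  "subset_sum_entropy c I =
     real (card I) * ln 2 - (\<Sum>A\<in>Pow I. ln (real (fibre_size c I (sum c A)))) / 2 ^ card I"

lemma fibre_size_pos:
  assumes "finite I" "A \<subseteq> I"
  shows "0 < fibre_size c I (sum c A)"
  using assms by (auto simp: fibre_size_def card_gt_0_iff)

lemma fibre_size_indicator:
  assumes "finite I"
  shows "real (fibre_size c I y) = (\<Sum>A\<in>Pow I. of_bool (sum c A = y))"
proof -
  have "(\<Sum>A\<in>Pow I. of_bool (sum c A = y)) = (\<Sum>A\<in>{A \<in> Pow I. sum c A = y}. (1::real))"
    using assms by (intro sum.mono_neutral_cong_right) auto
  then show ?thesis by (simp add: fibre_size_def)
qed

lemma sum_Pow_Un:
  fixes f :: "'a set \<Rightarrow> real"
  assumes "I \<inter> J = {}"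
  shows "(\<Sum>X\<in>Pow (I \<union> J). f X) = (\<Sum>A\<in>Pow I. \<Sum>B\<in>Pow J. f (A \<union> B))"
  unfolding sum.cartesian_product
  using assms
  by (intro sum.reindex_bij_witness[where j = "\<lambda>X. (X \<inter> I, X \<inter> J)" and i = "\<lambda>(A, B). A \<union> B"])
     (auto intro!: arg_cong[where f = f])

lemma sum_Pow_insert:
  fixes f :: "'a set \<Rightarrow> real"
  assumes "a \<notin> I"
  shows "(\<Sum>X\<in>Pow (insert a I). f X) = (\<Sum>A\<in>Pow I. f A + f (insert a A))"
  using sum_Pow_Un[of I "{a}" f] assms by (simp add: Pow_insert add.commute)

lemma fibre_size_Un:
  assumes "finite I" "finite J" "I \<inter> J = {}"
  shows "real (fibre_size c (I \<union> J) y) = (\<Sum>A\<in>Pow I. real (fibre_size c J (y - sum c A)))"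
proof -
  have "sum c (A \<union> B) = sum c A + sum c B" if "A \<subseteq> I" "B \<subseteq> J" for A B
    using that assms by (intro sum.union_disjoint) (auto intro: finite_subset)
  then show ?thesis
    using assms(3) unfolding fibre_size_indicator[OF finite_UnI[OF assms(1,2)]] fibre_size_indicator[OF assms(2)]
    by (auto simp: sum_Pow_Un algebra_simps intro!: sum.cong)
qed

lemma subset_sum_entropy_nonneg:
  assumes "finite I"
  shows "0 \<le> subset_sum_entropy c I"
proof -
  have "(\<Sum>A\<in>Pow I. ln (real (fibre_size c I (sum c A)))) \<le> (\<Sum>A\<in>Pow I. real (card I) * ln 2)"
  proof (intro sum_mono)
    fix A assume A: "A \<in> Pow I"
    have "fibre_size c I (sum c A) \<le> card (Pow I)"
      unfolding fibre_size_def using assms by (intro card_mono) auto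
    then have "real (fibre_size c I (sum c A)) \<le> 2 ^ card I"
      by (metis assms card_Pow of_nat_le_iff of_nat_numeral of_nat_power)
    then have "ln (real (fibre_size c I (sum c A))) \<le> ln (2 ^ card I)"
      using fibre_size_pos[OF assms, of A c] A by (intro ln_mono) auto
    then show "ln (real (fibre_size c I (sum c A))) \<le> real (card I) * ln 2"
      by (simp add: ln_realpow)
  qed
  then show ?thesis
    using assms by (simp add: subset_sum_entropy_def card_Pow divide_le_eq ac_simps)
qed

text \<open>
  The sum over \<open>I \<union> J\<close> is a function of the two independent partial sums. In terms of fibres: two
  sets in the fibres of \<open>A\<close> and \<open>B\<close> unite to a set in the fibre of \<open>A \<union> B\<close>, so fibre sizes are
  supermultiplicative.
\<close>

lemma subset_sum_entropy_Un_le: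
  assumes I: "finite I" and J: "finite J" and disj: "I \<inter> J = {}"
  shows "subset_sum_entropy c (I \<union> J) \<le> subset_sum_entropy c I + subset_sum_entropy c J"
proof -
  define S where "S K = (\<Sum>A\<in>Pow K. ln (real (fibre_size c K (sum c A))))" for K
  have ln_fibre: "ln (real (fibre_size c I (sum c A))) + ln (real (fibre_size c J (sum c B)))
      \<le> ln (real (fibre_size c (I \<union> J) (sum c (A \<union> B))))"
    if A: "A \<subseteq> I" and B: "B \<subseteq> J" for A B
  proof -
    have AB: "sum c (A \<union> B) = sum c A + sum c B"
      using A B I J disj by (intro sum.union_disjoint) (auto intro: finite_subset)
    have pos: "0 < fibre_size c I (sum c A)" "0 < fibre_size c J (sum c B)"
      using A B I J by (auto intro: fibre_size_pos)
    have "real (fibre_size c I (sum c A)) * real (fibre_size c J (sum c B))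
        = (\<Sum>A'\<in>Pow I. of_bool (sum c A' = sum c A) * real (fibre_size c J (sum c B)))"
      by (simp add: fibre_size_indicator[OF I] sum_distrib_right)
    also have "\<dots> \<le> (\<Sum>A'\<in>Pow I. real (fibre_size c J (sum c (A \<union> B) - sum c A')))"
      by (intro sum_mono) (simp add: AB)
    also have "\<dots> = real (fibre_size c (I \<union> J) (sum c (A \<union> B)))"
      by (rule fibre_size_Un[OF I J disj, symmetric])
    finally have "ln (real (fibre_size c I (sum c A)) * real (fibre_size c J (sum c B)))
        \<le> ln (real (fibre_size c (I \<union> J) (sum c (A \<union> B))))"
      using pos by (intro ln_mono) auto
    then show ?thesis using pos by (simp add: ln_mult)
  qed
  have "2 ^ card J * S I + 2 ^ card I * S J
      = (\<Sum>A\<in>Pow I. \<Sum>B\<in>Pow J. ln (real (fibre_size c I (sum c A))) + ln (real (fibre_size c J (sum c B))))"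
    using I J by (simp add: S_def sum.distrib card_Pow sum_distrib_left)
  also have "\<dots> \<le> (\<Sum>A\<in>Pow I. \<Sum>B\<in>Pow J. ln (real (fibre_size c (I \<union> J) (sum c (A \<union> B)))))"
    by (intro sum_mono ln_fibre) auto
  also have "\<dots> = S (I \<union> J)"
    unfolding S_def by (rule sum_Pow_Un[OF disj, symmetric])
  finally have "(2 ^ card J * S I + 2 ^ card I * S J) / 2 ^ (card I + card J) \<le> S (I \<union> J) / 2 ^ (card I + card J)"
    by (intro divide_right_mono) auto
  then have "S I / 2 ^ card I + S J / 2 ^ card J \<le> S (I \<union> J) / 2 ^ (card I + card J)"
    by (simp add: add_divide_distrib power_add)
  then show ?thesis
    using I J disj by (simp add: subset_sum_entropy_def S_def card_Un_disjoint algebra_simps)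
qed

text \<open>
  With \<open>P\<close> the law of \<open>sum c B\<close>, the left-hand side is \<open>2 ^ card J\<close> times the expectation of
  \<open>P (y + t) / P y\<close> under \<open>P\<close>, that is, times the sum of \<open>P (y + t)\<close> over the support of \<open>P\<close>.
\<close>

lemma sum_fibre_size_ratio_le:
  assumes J: "finite J"
  shows "(\<Sum>B\<in>Pow J. real (fibre_size c J (sum c B + t)) / real (fibre_size c J (sum c B))) \<le> 2 ^ card J"
proof -
  have "(\<Sum>B\<in>Pow J. real (fibre_size c J (sum c B + t)) / real (fibre_size c J (sum c B)))
      = (\<Sum>B\<in>Pow J. \<Sum>B'\<in>Pow J. of_bool (sum c B' = sum c B + t) / real (fibre_size c J (sum c B)))"
    by (simp add: fibre_size_indicator[OF J] sum_divide_distrib)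
  also have "\<dots> = (\<Sum>B'\<in>Pow J. \<Sum>B\<in>Pow J. of_bool (sum c B' = sum c B + t) / real (fibre_size c J (sum c B)))"
    by (rule sum.swap)
  also have "\<dots> \<le> (\<Sum>B'\<in>Pow J. 1)"
  proof (intro sum_mono)
    fix B'
    have "(\<Sum>B\<in>Pow J. of_bool (sum c B' = sum c B + t) / real (fibre_size c J (sum c B)))
        = (\<Sum>B\<in>Pow J. of_bool (sum c B = sum c B' - t) / real (fibre_size c J (sum c B' - t)))"
      by (intro sum.cong refl) (auto simp: of_bool_def)
    also have "\<dots> = real (fibre_size c J (sum c B' - t)) / real (fibre_size c J (sum c B' - t))"
      by (simp only: fibre_size_indicator[OF J] sum_divide_distrib)
    also have "\<dots> \<le> 1" by simp
    finally show "(\<Sum>B\<in>Pow J. of_bool (sum c B' = sum c B + t) / real (fibre_size c J (sum c B))) \<le> 1" .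
  qed
  finally show ?thesis using J by (simp add: card_Pow)
qed

text \<open>
  Adding an independent random variable cannot decrease entropy. This is Gibbs' inequality: by
  \<open>ln x \<le> x - 1\<close> the difference of the two entropies is controlled by the average ratio of the law on
  \<open>I \<union> J\<close> to the law on \<open>J\<close>. The former is a mixture of translates of the latter, so the average
  is at most 1.
\<close>

lemma subset_sum_entropy_le_Un:
  assumes I: "finite I" and J: "finite J" and disj: "I \<inter> J = {}"
  shows "subset_sum_entropy c J \<le> subset_sum_entropy c (I \<union> J)"
proof -
  define F where "F B = real (fibre_size c J (sum c B))" for B
  define G where "G A B = real (fibre_size c (I \<union> J) (sum c (A \<union> B)))" for A B
  have AB: "sum c (A \<union> B) = sum c A + sum c B" if "A \<subseteq> I" "B \<subseteq> J" for A B
    using that I J disj by (intro sum.union_disjoint) (auto intro: finite_subset)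
  have F: "0 < F B" if "B \<subseteq> J" for B
    using that J by (simp add: F_def fibre_size_pos)
  have G: "0 < G A B" if "A \<subseteq> I" "B \<subseteq> J" for A B
    using that I J unfolding G_def by (simp del: Un_iff) (intro fibre_size_pos; auto)
  have "(\<Sum>A\<in>Pow I. \<Sum>B\<in>Pow J. G A B / F B)
      = (\<Sum>A\<in>Pow I. \<Sum>B\<in>Pow J. \<Sum>A'\<in>Pow I. real (fibre_size c J (sum c B + (sum c A - sum c A'))) / F B)"
    unfolding G_def
    by (intro sum.cong refl) (simp add: fibre_size_Un[OF I J disj] AB sum_divide_distrib algebra_simps)
  also have "\<dots> = (\<Sum>A\<in>Pow I. \<Sum>A'\<in>Pow I. \<Sum>B\<in>Pow J. real (fibre_size c J (sum c B + (sum c A - sum c A'))) / F B)"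
    by (intro sum.cong refl sum.swap)
  also have "\<dots> \<le> (\<Sum>A\<in>Pow I. \<Sum>A'\<in>Pow I. 2 ^ card J)"
    unfolding F_def by (intro sum_mono sum_fibre_size_ratio_le J)
  also have "\<dots> = 2 ^ card I * 2 ^ card I * 2 ^ card J"
    using I by (simp add: card_Pow)
  finally have ratio: "(\<Sum>A\<in>Pow I. \<Sum>B\<in>Pow J. G A B / F B) \<le> 2 ^ card I * 2 ^ card I * 2 ^ card J" .
  have "(\<Sum>A\<in>Pow I. \<Sum>B\<in>Pow J. ln (G A B))
      \<le> (\<Sum>A\<in>Pow I. \<Sum>B\<in>Pow J. ln (F B) + card I * ln 2 + (G A B / F B) / 2 ^ card I - 1)"
  proof (intro sum_mono)
    fix A B assume "A \<in> Pow I" "B \<in> Pow J"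
    then have "0 < F B" "0 < G A B" using F G by auto
    then have "ln (G A B / (F B * 2 ^ card I)) \<le> G A B / (F B * 2 ^ card I) - 1"
      by (intro ln_le_minus_one) auto
    then show "ln (G A B) \<le> ln (F B) + card I * ln 2 + (G A B / F B) / 2 ^ card I - 1"
      using \<open>0 < F B\<close> \<open>0 < G A B\<close> by (simp add: ln_div ln_mult ln_realpow)
  qed
  also have "\<dots> = 2 ^ card I * (\<Sum>B\<in>Pow J. ln (F B)) + 2 ^ card I * 2 ^ card J * (card I * ln 2)
      + (\<Sum>A\<in>Pow I. \<Sum>B\<in>Pow J. G A B / F B) / 2 ^ card I - 2 ^ card I * 2 ^ card J"
    using I J by (simp add: sum.distrib sum_subtractf card_Pow sum_divide_distrib algebra_simps)
  also have "\<dots> \<le> 2 ^ card I * (\<Sum>B\<in>Pow J. ln (F B)) + 2 ^ card I * 2 ^ card J * (card I * ln 2)"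
    using ratio by (simp add: divide_le_eq ac_simps)
  finally have "(\<Sum>A\<in>Pow I. \<Sum>B\<in>Pow J. ln (G A B)) / 2 ^ (card I + card J)
     \<le> (\<Sum>B\<in>Pow J. ln (F B)) / 2 ^ card J + card I * ln 2"
    by (simp add: power_add field_simps)
  then show ?thesis
    using I J disj
    by (simp add: subset_sum_entropy_def sum_Pow_Un F_def G_def card_Un_disjoint algebra_simps)
qed

text \<open>
  Shannon entropy dominates the collision (second Renyi) entropy, by concavity of the logarithm.
  Here \<open>q\<close> is a bound for the probability that two independent sums coincide.
\<close>

lemma subset_sum_entropy_ge_collision:
  assumes I: "finite I" and "0 < q"
    and collisions: "(\<Sum>A\<in>Pow I. \<Sum>B\<in>Pow I. of_bool (sum c A = sum c B)) \<le> 4 ^ card I * q"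
  shows "- ln q \<le> subset_sum_entropy c I"
proof -
  \<comment> \<open>Concavity enters as the tangent line to the logarithm at \<open>m\<close>, the bound for the mean fibre size.\<close>
  define m :: real where "m = 2 ^ card I * q"
  have m: "0 < m" using \<open>0 < q\<close> by (simp add: m_def)
  have "(\<Sum>A\<in>Pow I. ln (real (fibre_size c I (sum c A))))
      \<le> (\<Sum>A\<in>Pow I. ln m + real (fibre_size c I (sum c A)) / m - 1)"
  proof (intro sum_mono)
    fix A assume "A \<in> Pow I"
    then have pos: "0 < real (fibre_size c I (sum c A))" using fibre_size_pos[OF I] by auto
    then have "ln (real (fibre_size c I (sum c A)) / m) \<le> real (fibre_size c I (sum c A)) / m - 1"
      using m by (intro ln_le_minus_one) auto
    then show "ln (real (fibre_size c I (sum c A))) \<le> ln m + real (fibre_size c I (sum c A)) / m - 1"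
      using pos m by (simp add: ln_div)
  qed
  also have "\<dots> = 2 ^ card I * ln m + (\<Sum>A\<in>Pow I. real (fibre_size c I (sum c A))) / m - 2 ^ card I"
    using I by (simp add: sum.distrib sum_subtractf card_Pow sum_divide_distrib)
  also have "(\<Sum>A\<in>Pow I. real (fibre_size c I (sum c A)))
      = (\<Sum>A\<in>Pow I. \<Sum>B\<in>Pow I. of_bool (sum c A = sum c B))"
    by (simp add: fibre_size_indicator[OF I] eq_commute)
  also have "2 ^ card I * ln m + \<dots> / m - 2 ^ card I \<le> 2 ^ card I * ln m"
  proof -
    have "(4::real) ^ card I * q = 2 ^ card I * m"
      by (simp add: m_def flip: power_mult_distrib)
    with collisions m show ?thesis by (simp add: divide_le_eq)
  qed
  also have "ln m = card I * ln 2 + ln q"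
    using \<open>0 < q\<close> by (simp add: m_def ln_mult ln_realpow)
  finally show ?thesis
    by (simp add: subset_sum_entropy_def field_simps)
qed

lemma subset_sum_entropy_scale:
  assumes "s \<noteq> 0"
  shows "subset_sum_entropy (\<lambda>i. s * c i) I = subset_sum_entropy c I"
  using assms by (simp add: subset_sum_entropy_def fibre_size_def flip: sum_distrib_left)

lemma subset_sum_entropy_image:
  assumes h: "inj_on h J"
  shows "subset_sum_entropy c (h ` J) = subset_sum_entropy (\<lambda>j. c (h j)) J"
proof -
  have sum_h: "sum c (h ` A) = (\<Sum>j\<in>A. c (h j))" if "A \<subseteq> J" for A
    using inj_on_subset[OF h that] by (simp add: sum.reindex)
  have inj: "inj_on (image h) (Pow J)"
    by (rule inj_on_image_Pow[OF h])
  have Pow_h: "Pow (h ` J) = image h ` Pow J"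
    by (simp add: image_Pow_surj)
  have "fibre_size c (h ` J) y = fibre_size (\<lambda>j. c (h j)) J y" for y
  proof -
    have "{A \<in> Pow (h ` J). sum c A = y} = image h ` {A \<in> Pow J. (\<Sum>j\<in>A. c (h j)) = y}"
      unfolding Pow_h using sum_h by auto
    moreover have "inj_on (image h) {A \<in> Pow J. (\<Sum>j\<in>A. c (h j)) = y}"
      by (rule inj_on_subset[OF inj]) auto
    ultimately show ?thesis by (simp add: fibre_size_def card_image)
  qed
  then show ?thesis
    unfolding subset_sum_entropy_def Pow_h sum.reindex[OF inj]
    using h sum_h by (simp add: card_image o_def)
qed

section \<open>Garsia's entropy as a limit\<close>

lemma level_entropy_eq_subset_sum_entropy:
  assumes \<beta>: "1 < \<beta>"
  shows "level_entropy \<beta> n = subset_sum_entropy (\<lambda>k. 1 / \<beta> ^ k) {1..n}"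
proof -
  let ?c = "\<lambda>k. 1 / \<beta> ^ k"
  let ?P = "Pow {1..n}"
  define ones where "ones a = {k \<in> {1..n}. a k = 1}" for a :: "nat \<Rightarrow> nat"
  define word where "word A = (\<lambda>k\<in>{1..n}. if k \<in> A then 1 else (0::nat))" for A
  have bij: "bij_betw ones (digit_words n) ?P"
  proof (rule bij_betw_byWitness[where f' = word])
    show "\<forall>a\<in>digit_words n. word (ones a) = a"
    proof
      fix a assume a: "a \<in> digit_words n"
      show "word (ones a) = a"
      proof
        fix k show "word (ones a) k = a k"
          using a PiE_mem[of a "{1..n}" "\<lambda>_. {0, 1}" k] PiE_arb[of a "{1..n}" "\<lambda>_. {0, 1}" k]
          by (auto simp: word_def ones_def digit_words_def)
      qed
    qed
  qed (auto simp: word_def ones_def digit_words_def split: if_splits)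
  have value_ones: "word_value \<beta> n a = sum ?c (ones a)" if "a \<in> digit_words n" for a
  proof -
    have "real (a k) / \<beta> ^ k = (if k \<in> ones a then ?c k else 0)" if "k \<in> {1..n}" for k
      using PiE_mem[of a "{1..n}" "\<lambda>_. {0, 1}" k] that \<open>a \<in> digit_words n\<close>
      by (auto simp: ones_def digit_words_def)
    then have "word_value \<beta> n a = (\<Sum>k=1..n. if k \<in> ones a then ?c k else 0)"
      unfolding word_value_def by (intro sum.cong refl) auto
    also have "\<dots> = sum ?c (ones a)"
      by (simp add: ones_def flip: sum.inter_filter)
    finally show ?thesis .
  qed
  have count: "word_count \<beta> n x = fibre_size ?c {1..n} x" for x
  proof -
    have "bij_betw ones {a \<in> digit_words n. x = word_value \<beta> n a} {A \<in> ?P. sum ?c A = x}"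
      using bij by (rule bij_betw_Collect) (auto simp: value_ones)
    then show ?thesis by (simp add: word_count_def fibre_size_def bij_betw_same_card)
  qed
  have in_interval: "sum ?c A \<in> beta_interval \<beta>" if "A \<subseteq> {1..n}" for A
  proof -
    have "sum ?c A \<le> (\<Sum>k=1..n. (1 / \<beta>) ^ k)"
      unfolding power_divide power_one using that \<beta> by (intro sum_mono2) auto
    also have "\<dots> \<le> 1 / (\<beta> - 1)"
    proof -
      have "(\<beta> - 1) * (\<Sum>k=1..m. (1 / \<beta>) ^ k) = 1 - (1 / \<beta>) ^ m" for m
      proof (induction m)
        case (Suc m)
        have "(\<beta> - 1) * (1 / \<beta>) ^ Suc m = (1 / \<beta>) ^ m - (1 / \<beta>) ^ Suc m"
          using \<beta> by (simp add: field_simps)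
        with Suc show ?case by (simp add: distrib_left del: power_Suc)
      qed simp
      then have "(\<Sum>k=1..n. (1 / \<beta>) ^ k) * (\<beta> - 1) \<le> 1" using \<beta> by (simp add: mult.commute)
      then show ?thesis using \<beta> by (simp add: pos_le_divide_eq)
    qed
    finally show ?thesis using \<beta> by (simp add: beta_interval_def sum_nonneg)
  qed
  have D: "D_set \<beta> n = sum ?c ` ?P"
  proof -
    have "{x. \<exists>a\<in>digit_words n. x = word_value \<beta> n a} = (\<lambda>a. sum ?c (ones a)) ` digit_words n"
      using value_ones by auto
    also have "\<dots> = sum ?c ` ?P"
      using bij_betw_imp_surj_on[OF bij] by (simp flip: image_image)
    finally show ?thesis using in_interval by (auto simp: D_set_def)
  qed
  let ?F = "\<lambda>x. real (fibre_size ?c {1..n} x)"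
  have group: "(\<Sum>A\<in>?P. f (sum ?c A)) = (\<Sum>x\<in>sum ?c ` ?P. ?F x * f x)" for f :: "real \<Rightarrow> real"
    by (subst sum.image_gen[where g = "sum ?c"]) (auto simp: fibre_size_def intro!: sum.cong)
  have "level_entropy \<beta> n = - (\<Sum>x\<in>sum ?c ` ?P. ?F x * (ln (?F x / 2 ^ n) / 2 ^ n))"
    by (simp add: level_entropy_def D count)
  also have "\<dots> = - (\<Sum>A\<in>?P. ln (?F (sum ?c A) / 2 ^ n) / 2 ^ n)"
    by (simp only: group[symmetric])
  also have "\<dots> = - (\<Sum>A\<in>?P. (ln (?F (sum ?c A)) - n * ln 2) / 2 ^ n)"
    using fibre_size_pos[of "{1..n}" _ ?c]
    by (intro arg_cong[where f = uminus] sum.cong refl) (auto simp: ln_div ln_realpow)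
  also have "\<dots> = subset_sum_entropy ?c {1..n}"
    by (simp add: subset_sum_entropy_def sum_subtractf card_Pow diff_divide_distrib flip: sum_divide_distrib)
  finally show ?thesis .
qed

text \<open>
  Fekete's lemma: division with remainder by a fixed \<open>m\<close> gives \<open>limsup u n / n \<le> u m / m\<close>, hence the
  limit is the infimum of \<open>u m / m\<close>.
\<close>

lemma subadditive_divide_convergent:
  fixes u :: "nat \<Rightarrow> real"
  assumes nonneg: "\<And>n. 0 \<le> u n" and sub: "\<And>m n. u (m + n) \<le> u m + u n"
  shows "convergent (\<lambda>n. u n / real n)"
proof -
  define L where "L = Inf ((\<lambda>n. u n / real n) ` {1..})"
  have bdd: "bdd_below ((\<lambda>n. u n / real n) ` {1..})"
    using nonneg by (intro bdd_belowI[of _ 0]) auto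
  have L_le: "L \<le> u n / real n" if "1 \<le> n" for n
    unfolding L_def using that bdd by (intro cInf_lower) auto
  have u_mult: "u (q * m + r) \<le> real q * u m + u r" for q m r
  proof (induction q)
    case (Suc q)
    then show ?case using sub[of m "q * m + r"] by (simp add: algebra_simps)
  qed simp
  have "(\<lambda>n. u n / real n) \<longlonglongrightarrow> L"
  proof (rule LIMSEQ_I)
    fix e :: real assume e: "0 < e"
    have "\<exists>x\<in>(\<lambda>n. u n / real n) ` {1..}. x < L + e / 2"
      using cInf_less_iff[OF _ bdd, of "L + e / 2"] e by (auto simp: L_def)
    then obtain m where m: "1 \<le> m" "u m / real m < L + e / 2" by auto
    define K where "K = (\<Sum>r<m. u r)"
    have K: "u r \<le> K" if "r < m" for r
      unfolding K_def using that nonneg by (intro member_le_sum) auto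
    obtain N :: nat where N: "2 * K / e < real N" using reals_Archimedean2 by blast
    show "\<exists>N. \<forall>n\<ge>N. norm (u n / real n - L) < e"
    proof (intro exI[of _ "Suc N"] allI impI)
      fix n assume n: "Suc N \<le> n"
      have "u n \<le> real (n div m) * u m + u (n mod m)"
        using u_mult[of "n div m" m "n mod m"] by simp
      also have "\<dots> \<le> real n / real m * u m + K"
        using m(1) nonneg K[of "n mod m"] by (intro add_mono mult_right_mono of_nat_div_le_of_nat) auto
      finally have "u n / real n \<le> (real n / real m * u m + K) / real n"
        using n by (intro divide_right_mono) auto
      also have "\<dots> = u m / real m + K / real n" using n by (simp add: field_simps)
      also have "K / real n < e / 2"
      proof -
        have "2 * K / e < real n" using N n by linarith
        then show ?thesis using e n by (simp add: field_simps)
      qed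
      finally have "u n / real n < L + e" using m(2) by simp
      moreover have "L \<le> u n / real n" using L_le n by simp
      ultimately show "norm (u n / real n - L) < e" by simp
    qed
  qed
  then show ?thesis by (rule convergentI)
qed

lemma level_entropy_nonneg: "1 < \<beta> \<Longrightarrow> 0 \<le> level_entropy \<beta> n"
  by (simp add: level_entropy_eq_subset_sum_entropy subset_sum_entropy_nonneg)

text \<open>
  The last \<open>n\<close> of \<open>m + n\<close> digits contribute a copy of the sum of length \<open>n\<close> scaled by \<open>1 / \<beta> ^ m\<close>.
\<close>

lemma level_entropy_subadditive:
  assumes \<beta>: "1 < \<beta>"
  shows "level_entropy \<beta> (m + n) \<le> level_entropy \<beta> m + level_entropy \<beta> n"
proof -
  let ?c = "\<lambda>k. 1 / \<beta> ^ k"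
  have split: "{1..m + n} = {1..m} \<union> (+) m ` {1..n}"
    by (auto simp: image_add_atLeastAtMost)
  have "subset_sum_entropy ?c {1..m + n} \<le> subset_sum_entropy ?c {1..m} + subset_sum_entropy ?c ((+) m ` {1..n})"
    unfolding split by (intro subset_sum_entropy_Un_le) auto
  also have "subset_sum_entropy ?c ((+) m ` {1..n}) = subset_sum_entropy (\<lambda>k. (1 / \<beta> ^ m) * (1 / \<beta> ^ k)) {1..n}"
    by (subst subset_sum_entropy_image) (auto simp: power_add)
  also have "\<dots> = subset_sum_entropy ?c {1..n}"
    using \<beta> by (intro subset_sum_entropy_scale) auto
  finally show ?thesis
    using \<beta> by (simp add: level_entropy_eq_subset_sum_entropy)
qed

lemma garsia_entropy_limit:
  assumes \<beta>: "1 < \<beta>"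
  shows "(\<lambda>n. level_entropy \<beta> n / (real n * ln \<beta>)) \<longlonglongrightarrow> garsia_entropy \<beta>"
proof -
  have "convergent (\<lambda>n. level_entropy \<beta> n / real n)"
    using \<beta> by (intro subadditive_divide_convergent level_entropy_nonneg level_entropy_subadditive)
  then have "convergent (\<lambda>n. level_entropy \<beta> n / real n * (1 / ln \<beta>))"
    by (intro convergent_mult convergent_const)
  then show ?thesis
    by (simp add: convergent_LIMSEQ_iff garsia_entropy_def)
qed

text \<open>
  The digits at the multiples of \<open>k\<close> form an expansion in base \<open>\<beta> ^ k\<close>. The remaining digits are
  independent of them and therefore only add entropy. In the limit, Garsia's entropy of \<open>\<beta>\<close> is at
  least that of \<open>\<beta> ^ k\<close>.
\<close>

lemma level_entropy_power_le:
  assumes \<beta>: "1 < \<beta>" and k: "1 \<le> k"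
  shows "level_entropy (\<beta> ^ k) (n div k) \<le> level_entropy \<beta> n"
proof -
  let ?c = "\<lambda>i. 1 / \<beta> ^ i" and ?J = "(*) k ` {1..n div k}"
  have J: "?J \<subseteq> {1..n}"
  proof
    fix i assume "i \<in> ?J"
    then obtain j where "i = k * j" "1 \<le> j" "j \<le> n div k"
      unfolding image_iff Bex_def atLeastAtMost_iff by blast
    then show "i \<in> {1..n}" using k by (simp add: less_eq_div_iff_mult_less_eq mult.commute)
  qed
  have "level_entropy (\<beta> ^ k) (n div k) = subset_sum_entropy ?c ?J"
    using \<beta> k
    by (subst subset_sum_entropy_image) (auto simp: level_entropy_eq_subset_sum_entropy power_mult inj_on_def)
  also have "\<dots> \<le> subset_sum_entropy ?c (({1..n} - ?J) \<union> ?J)"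
    by (intro subset_sum_entropy_le_Un) auto
  also have "({1..n} - ?J) \<union> ?J = {1..n}" using J by auto
  finally show ?thesis using \<beta> by (simp add: level_entropy_eq_subset_sum_entropy)
qed

section \<open>Collisions and supersolutions of the difference walk\<close>

text \<open>
  The rescaled difference \<open>\<gamma> ^ n * D A B\<close> of two random sums is a walk started at 0 whose step
  is \<open>x \<mapsto> \<gamma> * x + \<epsilon>\<close>, with \<open>\<epsilon> = -1, 0, 1\<close> arising from 1, 2, 1 of the four pairs of new digits.
  The hypothesis on \<open>g\<close> says that the total of \<open>g\<close> over all pairs of words grows by at most the
  factor \<open>\<kappa>\<close> at each step.
\<close>

lemma difference_potential_le:
  fixes g :: "real \<Rightarrow> real"
  assumes \<gamma>: "\<gamma> \<noteq> 0" and \<kappa>: "0 \<le> \<kappa>"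
    and super: "\<And>x. g (\<gamma> * x - 1) + 2 * g (\<gamma> * x) + g (\<gamma> * x + 1) \<le> \<kappa> * g x"
  defines "D A B \<equiv> (\<Sum>k\<in>A. 1 / \<gamma> ^ k) - (\<Sum>k\<in>B. 1 / \<gamma> ^ k)"
  shows "(\<Sum>A\<in>Pow {1..n}. \<Sum>B\<in>Pow {1..n}. g (\<gamma> ^ n * D A B)) \<le> \<kappa> ^ n * g 0"
proof (induction n)
  case 0
  then show ?case by (simp add: D_def)
next
  case (Suc n)
  have ins: "sum f (insert (Suc n) A) = f (Suc n) + sum f A" if "A \<subseteq> {1..n}" for f :: "nat \<Rightarrow> real" and A
    using that by (subst sum.insert) (auto intro: finite_subset)
  have cancel: "\<gamma> ^ Suc n * (1 / \<gamma> ^ Suc n) = 1" using \<gamma> by simp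
  have step: "g (\<gamma> ^ Suc n * D A B) + g (\<gamma> ^ Suc n * D A (insert (Suc n) B))
      + (g (\<gamma> ^ Suc n * D (insert (Suc n) A) B) + g (\<gamma> ^ Suc n * D (insert (Suc n) A) (insert (Suc n) B)))
      \<le> \<kappa> * g (\<gamma> ^ n * D A B)" if A: "A \<subseteq> {1..n}" and B: "B \<subseteq> {1..n}" for A B
  proof -
    have "\<gamma> ^ Suc n * D A B = \<gamma> * (\<gamma> ^ n * D A B)" by simp
    moreover have "\<gamma> ^ Suc n * D A (insert (Suc n) B) = \<gamma> * (\<gamma> ^ n * D A B) - 1"
      unfolding D_def ins[OF B] using cancel by (simp only: diff_diff_eq2 algebra_simps) simp
    moreover have "\<gamma> ^ Suc n * D (insert (Suc n) A) B = \<gamma> * (\<gamma> ^ n * D A B) + 1"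
      unfolding D_def ins[OF A] using cancel by (simp only: algebra_simps) simp
    moreover have "D (insert (Suc n) A) (insert (Suc n) B) = D A B"
      unfolding D_def ins[OF A] ins[OF B] by simp
    ultimately show ?thesis using super[of "\<gamma> ^ n * D A B"] by (simp only:)
  qed
  have "(\<Sum>A\<in>Pow {1..Suc n}. \<Sum>B\<in>Pow {1..Suc n}. g (\<gamma> ^ Suc n * D A B))
      = (\<Sum>A\<in>Pow {1..n}. \<Sum>B\<in>Pow {1..n}.
           g (\<gamma> ^ Suc n * D A B) + g (\<gamma> ^ Suc n * D A (insert (Suc n) B))
           + (g (\<gamma> ^ Suc n * D (insert (Suc n) A) B) + g (\<gamma> ^ Suc n * D (insert (Suc n) A) (insert (Suc n) B))))"
    by (simp only: atLeastAtMostSuc_conv[of 1] sum_Pow_insert sum.distrib)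
       (simp add: sum_Pow_insert sum.distrib atLeastAtMostSuc_conv)
  also have "\<dots> \<le> (\<Sum>A\<in>Pow {1..n}. \<Sum>B\<in>Pow {1..n}. \<kappa> * g (\<gamma> ^ n * D A B))"
    by (intro sum_mono step) auto
  also have "\<dots> = \<kappa> * (\<Sum>A\<in>Pow {1..n}. \<Sum>B\<in>Pow {1..n}. g (\<gamma> ^ n * D A B))"
    by (simp add: sum_distrib_left)
  also have "\<dots> \<le> \<kappa> * (\<kappa> ^ n * g 0)"
    using Suc.IH \<kappa> by (intro mult_left_mono)
  finally show ?case by (simp add: mult.assoc)
qed

text \<open>
  Two sums coincide exactly when the difference walk is at 0. Bounding the indicator of 0 by
  \<open>g / g 0\<close> shows that the collision probability is at most \<open>\<rho> ^ n\<close>.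
\<close>

lemma level_entropy_ge_supersolution:
  fixes g :: "real \<Rightarrow> real"
  assumes \<gamma>: "1 < \<gamma>" and \<rho>: "0 < \<rho>" and nonneg: "\<And>x. 0 \<le> g x" and pos: "0 < g 0"
    and super: "\<And>x. g (\<gamma> * x - 1) + 2 * g (\<gamma> * x) + g (\<gamma> * x + 1) \<le> 4 * \<rho> * g x"
  shows "- (real n * ln \<rho>) \<le> level_entropy \<gamma> n"
proof -
  let ?c = "\<lambda>k. 1 / \<gamma> ^ k" and ?P = "Pow {1..n}"
  have "(\<Sum>A\<in>?P. \<Sum>B\<in>?P. of_bool (sum ?c A = sum ?c B)) * g 0
      = (\<Sum>A\<in>?P. \<Sum>B\<in>?P. of_bool (sum ?c A = sum ?c B) * g 0)"
    by (simp only: sum_distrib_right)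
  also have "\<dots> \<le> (\<Sum>A\<in>?P. \<Sum>B\<in>?P. g (\<gamma> ^ n * (sum ?c A - sum ?c B)))"
    using nonneg by (intro sum_mono) auto
  also have "\<dots> \<le> (4 * \<rho>) ^ n * g 0"
    using \<gamma> \<rho> super by (intro difference_potential_le) auto
  finally have "(\<Sum>A\<in>?P. \<Sum>B\<in>?P. of_bool (sum ?c A = sum ?c B)) \<le> 4 ^ n * \<rho> ^ n"
    using pos by (simp add: power_mult_distrib)
  then have "- ln (\<rho> ^ n) \<le> subset_sum_entropy ?c {1..n}"
    using \<rho> by (intro subset_sum_entropy_ge_collision) auto
  then show ?thesis
    using \<gamma> \<rho> by (simp add: level_entropy_eq_subset_sum_entropy ln_realpow)
qed

section \<open>Step functions as supersolutions\<close>

text \<open>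
  A supersolution is sought as an even function which is constant on the cells
  \<open>j / M \<le> \<bar>x\<bar> < (j + 1) / M\<close>. Its values are listed in decreasing order. The list is continued by
  zeros to the right, and by its first element to the left, so that negative lower bounds for
  \<open>\<bar>x\<bar>\<close> need no special treatment.
\<close>

fun step_value :: "int list \<Rightarrow> int \<Rightarrow> int" where
  "step_value [] i = 0"
| "step_value (v # vs) i = (if i \<le> 0 then v else step_value vs (i - 1))"

text \<open>
  If \<open>x \<ge> 0\<close> lies in cell \<open>j\<close> and \<open>p / 100 \<le> \<gamma> \<le> q / 100\<close>, then the arguments of \<^const>\<open>step_value\<close>
  below are lower bounds for the cells of \<open>\<gamma> * x - 1\<close>, \<open>\<gamma> * x\<close> and \<open>\<gamma> * x + 1\<close>. By monotonicity the
  three function values are then bounded above. The two entries of the maximum cover the cases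
  \<open>\<gamma> * x \<ge> 1\<close> and \<open>\<gamma> * x \<le> 1\<close>.
\<close>

fun cells_ok :: "int \<Rightarrow> int \<Rightarrow> int \<Rightarrow> int \<Rightarrow> int list \<Rightarrow> int \<Rightarrow> int list \<Rightarrow> bool" where
  "cells_ok p q M r gs j [] \<longleftrightarrow> True"
| "cells_ok p q M r gs j (v # vs) \<longleftrightarrow>
     1000 * (step_value gs (max (p * j div 100 - M) ((100 * M - q * (j + 1)) div 100))
       + 2 * step_value gs (p * j div 100) + step_value gs (p * j div 100 + M)) \<le> 4 * r * v
     \<and> cells_ok p q M r gs (j + 1) vs"

text \<open>
  The growth factor is \<open>4 * r / 1000\<close>, and the inequality between powers says
  \<open>r / 1000 \<le> (q / 100) powr (- 7 / 8)\<close>. The last inequality ensures that points beyond the final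
  cell stay there: there \<open>\<bar>x\<bar> \<ge> 1 / (\<gamma> - 1)\<close>, and the walk never returns.
\<close>

definition certificate :: "int \<Rightarrow> int \<Rightarrow> int \<Rightarrow> int \<Rightarrow> int list \<Rightarrow> bool" where
  "certificate p q M r gs \<longleftrightarrow>
     100 \<le> p \<and> 0 < M \<and> 0 < r \<and> r ^ 8 * q ^ 7 \<le> 1000 ^ 8 * 100 ^ 7 \<and>
     gs \<noteq> [] \<and> 0 < hd gs \<and> successively (\<ge>) (gs @ [0]) \<and>
     100 * (int (length gs) + M) \<le> p * int (length gs) \<and> cells_ok p q M r gs 0 gs"

lemma step_value_in: "step_value gs i \<in> insert 0 (set gs)"
  by (induction gs i rule: step_value.induct) auto

lemma step_value_nth: "i < length gs \<Longrightarrow> step_value gs (int i) = gs ! i"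
  by (induction gs arbitrary: i) (auto simp: nth_Cons split: nat.split)

lemma step_value_beyond: "int (length gs) \<le> i \<Longrightarrow> step_value gs i = 0"
  by (induction gs i rule: step_value.induct) auto

lemma step_value_antimono:
  assumes "sorted_wrt (\<ge>) (gs @ [0])" "i \<le> j"
  shows "step_value gs j \<le> step_value gs i"
  using assms
proof (induction gs arbitrary: i j)
  case (Cons v vs)
  then have "step_value vs (j - 1) \<le> v"
    using step_value_in[of vs "j - 1"] by auto
  with Cons show ?case by auto
qed simp

lemma step_value_nonneg:
  assumes "sorted_wrt (\<ge>) (gs @ [0])"
  shows "0 \<le> step_value gs i"
  using assms step_value_in[of gs i] by (auto simp: sorted_wrt_append)

lemma cells_ok_nth:
  assumes "cells_ok p q M r gs j vs" "i < length vs"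
  shows "1000 * (step_value gs (max (p * (j + int i) div 100 - M) ((100 * M - q * (j + int i + 1)) div 100))
       + 2 * step_value gs (p * (j + int i) div 100) + step_value gs (p * (j + int i) div 100 + M))
     \<le> 4 * r * vs ! i"
  using assms
proof (induction vs arbitrary: i j)
  case (Cons v vs)
  show ?case
  proof (cases i)
    case 0
    with Cons.prems show ?thesis by simp
  next
    case (Suc i')
    with Cons.prems Cons.IH[of "j + 1" i'] show ?thesis by (simp add: ac_simps)
  qed
qed simp

definition step_function :: "int \<Rightarrow> int list \<Rightarrow> real \<Rightarrow> real" where
  "step_function M gs x = of_int (step_value gs \<lfloor>of_int M * \<bar>x\<bar>\<rfloor>)"

lemma certificate_supersolution:
  assumes cert: "certificate p q M r gs" and p: "of_int p \<le> 100 * \<gamma>" and q: "100 * \<gamma> \<le> of_int q"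
  defines "g \<equiv> step_function M gs"
  shows "g (\<gamma> * x - 1) + 2 * g (\<gamma> * x) + g (\<gamma> * x + 1) \<le> 4 * (of_int r / 1000) * g x"
proof -
  \<comment> \<open>The floor is best bounded on the integer side, before casts are pushed inwards.\<close>
  note [simp del] = of_int_add of_int_mult of_int_diff
  have M: "0 < M" and "100 \<le> p" and mono: "sorted_wrt (\<ge>) (gs @ [0])"
    and len: "100 * (int (length gs) + M) \<le> p * int (length gs)"
    and cells: "cells_ok p q M r gs 0 gs" and r: "0 < r"
    using cert by (auto simp: certificate_def successively_conv_sorted_wrt transp_def)
  have pos: "g (\<gamma> * y - 1) + 2 * g (\<gamma> * y) + g (\<gamma> * y + 1) \<le> 4 * (of_int r / 1000) * g y"
    if y: "0 \<le> y" for y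
  proof -
    define j where "j = \<lfloor>of_int M * y\<rfloor>"
    define a where "a = p * j div 100"
    define c where "c = max (a - M) ((100 * M - q * (j + 1)) div 100)"
    have j0: "0 \<le> j" using y M by (simp add: j_def)
    have jy: "of_int j \<le> of_int M * y" "of_int M * y \<le> of_int (j + 1)"
      unfolding j_def by linarith+
    have g100: "0 \<le> \<gamma>" using p \<open>100 \<le> p\<close> by linarith
    have "of_int (p * j) \<le> (100 * \<gamma>) * (of_int M * y)"
      unfolding of_int_mult using p jy(1) j0 g100 by (intro mult_mono) auto
    then have lo: "of_int (p * j) / 100 \<le> of_int M * (\<gamma> * y)" by (simp add: field_simps)
    have "(100 * \<gamma>) * (of_int M * y) \<le> of_int (q * (j + 1))"
      unfolding of_int_mult using q jy(2) y M g100 by (intro mult_mono) auto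
    then have hi: "of_int M * (\<gamma> * y) \<le> of_int (q * (j + 1)) / 100" by (simp add: field_simps)
    \<comment> \<open>\<open>a\<close> and \<open>c\<close> bound the cells of \<open>\<gamma> * y\<close> and \<open>\<bar>\<gamma> * y - 1\<bar>\<close> from below.\<close>
    have floor100: "of_int (k div 100) \<le> (of_int k / 100 :: real)" for k :: int
      by linarith
    have alo: "of_int a \<le> of_int M * (\<gamma> * y)"
      using lo floor100[of "p * j"] unfolding a_def by linarith
    have "of_int (a - M) \<le> of_int M * \<bar>\<gamma> * y - 1\<bar>"
    proof -
      have "of_int (a - M) \<le> of_int M * (\<gamma> * y - 1)"
        using alo by (simp add: of_int_diff algebra_simps)
      also have "\<dots> \<le> of_int M * \<bar>\<gamma> * y - 1\<bar>" using M by (intro mult_left_mono) auto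
      finally show ?thesis .
    qed
    moreover have "of_int ((100 * M - q * (j + 1)) div 100) \<le> of_int M * \<bar>\<gamma> * y - 1\<bar>"
    proof -
      have "of_int ((100 * M - q * (j + 1)) div 100) \<le> (of_int (100 * M - q * (j + 1)) / 100 :: real)"
        by (rule floor100)
      also have "\<dots> = of_int M - of_int (q * (j + 1)) / 100"
        by (simp add: of_int_diff of_int_mult diff_divide_distrib)
      also have "\<dots> \<le> of_int M * (1 - \<gamma> * y)" using hi by (simp add: algebra_simps)
      also have "\<dots> \<le> of_int M * \<bar>\<gamma> * y - 1\<bar>" using M by (intro mult_left_mono) auto
      finally show ?thesis .
    qed
    ultimately have c: "c \<le> \<lfloor>of_int M * \<bar>\<gamma> * y - 1\<bar>\<rfloor>"
      by (simp add: c_def le_floor_iff)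
    have "a \<le> \<lfloor>of_int M * \<bar>\<gamma> * y\<bar>\<rfloor>"
      using alo g100 y by (simp add: le_floor_iff)
    moreover have "a + M \<le> \<lfloor>of_int M * \<bar>\<gamma> * y + 1\<bar>\<rfloor>"
      using alo g100 y by (simp add: le_floor_iff of_int_add algebra_simps)
    ultimately have "g (\<gamma> * y - 1) + 2 * g (\<gamma> * y) + g (\<gamma> * y + 1)
        \<le> of_int (step_value gs c + 2 * step_value gs a + step_value gs (a + M))"
      using c unfolding g_def step_function_def of_int_add of_int_mult
      by (intro add_mono mult_mono) (auto intro: step_value_antimono[OF mono] step_value_nonneg[OF mono])
    also have "\<dots> \<le> of_int (4 * r * step_value gs j) / 1000"
    proof (cases "j < int (length gs)")
      case True
      then obtain i where i: "j = int i" "i < length gs" using j0 by (metis nonneg_int_cases of_nat_less_iff)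
      have "1000 * (step_value gs c + 2 * step_value gs a + step_value gs (a + M)) \<le> 4 * r * step_value gs j"
        using cells_ok_nth[OF cells i(2)] i by (simp add: a_def c_def step_value_nth)
      then have "real_of_int (1000 * (step_value gs c + 2 * step_value gs a + step_value gs (a + M)))
          \<le> of_int (4 * r * step_value gs j)"
        by (simp only: of_int_le_iff)
      then show ?thesis unfolding of_int_mult[of 1000] by simp
    next
      case False
      have "100 * (int (length gs) + M) \<le> 100 * (int (length gs) + M) + 100 * (j - int (length gs))"
        using False by simp
      also have "\<dots> \<le> p * int (length gs) + p * (j - int (length gs))"
        using len \<open>100 \<le> p\<close> False by (intro add_mono mult_right_mono) auto
      also have "\<dots> = p * j" by (simp add: algebra_simps)
      finally have "100 * (int (length gs) + M) \<le> p * j" .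
      from zdiv_mono1[OF this, of 100] have "int (length gs) + M \<le> a" by (simp add: a_def)
      then have "step_value gs c = 0" "step_value gs a = 0" "step_value gs (a + M) = 0"
        using M by (auto intro!: step_value_beyond simp: c_def)
      then show ?thesis using False by (simp add: step_value_beyond)
    qed
    also have "\<dots> = 4 * (of_int r / 1000) * g y"
      using y by (simp add: g_def step_function_def j_def of_int_mult)
    finally show ?thesis .
  qed
  have even: "g (- z) = g z" for z by (simp add: g_def step_function_def)
  show ?thesis
  proof (cases "0 \<le> x")
    case False
    have "g (\<gamma> * - x - 1) = g (\<gamma> * x + 1)" "g (\<gamma> * - x + 1) = g (\<gamma> * x - 1)" "g (\<gamma> * - x) = g (\<gamma> * x)"
      using even[of "\<gamma> * x + 1"] even[of "\<gamma> * x - 1"] even[of "\<gamma> * x"]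
      by (simp_all add: minus_add_distrib)
    moreover have "g (\<gamma> * - x - 1) + 2 * g (\<gamma> * - x) + g (\<gamma> * - x + 1) \<le> 4 * (of_int r / 1000) * g (- x)"
      using False by (intro pos) simp
    ultimately show ?thesis unfolding even by linarith
  qed (rule pos)
qed

lemma certificate_step_function:
  assumes "certificate p q M r gs"
  shows "0 \<le> step_function M gs x" and "0 < step_function M gs 0"
proof -
  have mono: "sorted_wrt (\<ge>) (gs @ [0])" and "gs \<noteq> []" and "0 < hd gs"
    using assms by (auto simp: certificate_def successively_conv_sorted_wrt transp_def)
  show "0 \<le> step_function M gs x"
    by (simp add: step_function_def step_value_nonneg[OF mono])
  obtain v vs where "gs = v # vs" using \<open>gs \<noteq> []\<close> by (cases gs) auto
  then show "0 < step_function M gs 0" using \<open>0 < hd gs\<close> by (simp add: step_function_def)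
qed

lemma level_entropy_ge_certificate:
  assumes cert: "certificate p q M r gs" and p: "of_int p \<le> 100 * \<gamma>" and q: "100 * \<gamma> \<le> of_int q"
    and \<gamma>: "1 < \<gamma>"
  shows "7 / 8 * (real n * ln \<gamma>) \<le> level_entropy \<gamma> n"
proof -
  define \<rho> :: real where "\<rho> = of_int r / 1000"
  have r: "0 < r" and rq: "r ^ 8 * q ^ 7 \<le> 1000 ^ 8 * 100 ^ 7"
    using cert by (auto simp: certificate_def)
  have \<rho>: "0 < \<rho>" using r by (simp add: \<rho>_def)
  have "\<rho> ^ 8 * \<gamma> ^ 7 \<le> \<rho> ^ 8 * (of_int q / 100) ^ 7"
    using \<gamma> q \<rho> by (intro mult_left_mono power_mono) auto
  also have "\<dots> = of_int (r ^ 8 * q ^ 7) / (1000 ^ 8 * 100 ^ 7)"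
    by (simp add: \<rho>_def power_divide)
  also have "\<dots> \<le> of_int (1000 ^ 8 * 100 ^ 7) / (1000 ^ 8 * 100 ^ 7)"
    using rq by (intro divide_right_mono) (auto simp only: of_int_le_iff, simp)
  finally have "\<rho> ^ 8 * \<gamma> ^ 7 \<le> 1" by simp
  then have "ln (\<rho> ^ 8 * \<gamma> ^ 7) \<le> 0" using \<rho> \<gamma> by (subst ln_le_zero_iff) auto
  then have "7 / 8 * ln \<gamma> \<le> - ln \<rho>" using \<rho> \<gamma> by (simp add: ln_mult ln_realpow)
  then have "real n * (7 / 8 * ln \<gamma>) \<le> real n * (- ln \<rho>)" by (intro mult_left_mono) auto
  moreover have "- (real n * ln \<rho>) \<le> level_entropy \<gamma> n"
    using \<gamma> \<rho> certificate_step_function[OF cert] certificate_supersolution[OF cert p q]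
    unfolding \<rho>_def by (intro level_entropy_ge_supersolution) auto
  ultimately show ?thesis by simp
qed

section \<open>Supersolutions for bases between 1.41 and 2\<close>

text \<open>
  Twelve certificates cover the bases from 1.41 to 2. Each list approximates the dominant
  eigenvector of the discretised operator for the range of bases in question, rounded to integers
  in such a way that all inequalities persist. For smaller bases the walk lives on a longer
  interval and spreads less per step, so that shorter ranges and longer lists are needed.
\<close>

lemma certificate_141_143:
  "certificate 141 143 27 731
    [1010, 1010, 1010, 997, 996, 982, 973, 973, 939, 936, 898, 880, 861, 819, 813, 769,
     741, 719, 675, 667, 623, 603, 561, 529, 519, 470, 460, 418, 399, 372, 331, 319, 280,
     270, 249, 216, 204, 176, 170, 152, 134, 118, 99, 95, 76, 71, 61, 52, 46, 34, 33, 26,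
     21, 18, 12, 12, 9, 7, 5, 4, 3, 2, 2, 1, 1, 1]"
  by code_simp

lemma certificate_143_146:
  "certificate 143 146 32 718
    [1000, 1000, 1000, 980, 980, 965, 964, 942, 942, 927, 898, 890, 866, 863, 818, 810,
     794, 765, 749, 717, 693, 661, 642, 632, 596, 568, 537, 518, 483, 469, 442, 416, 403,
     363, 352, 323, 304, 287, 260, 253, 221, 209, 184, 176, 164, 147, 132, 116, 108, 92,
     89, 78, 65, 62, 52, 46, 38, 33, 31, 23, 22, 17, 14, 11, 9, 8, 5, 4, 3, 2, 2, 1, 1, 1,
     1]"
  by code_simp

lemma certificate_146_150:
  "certificate 146 150 38 701
    [1000, 1000, 1000, 994, 994, 981, 980, 971, 957, 950, 948, 917, 912, 904, 882, 873,
     844, 823, 806, 793, 760, 748, 715, 699, 668, 656, 634, 614, 591, 561, 547, 522, 497,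
     473, 454, 431, 416, 386, 368, 359, 327, 316, 289, 275, 254, 245, 218, 210, 188, 178,
     160, 152, 142, 130, 119, 104, 99, 88, 78, 68, 64, 55, 51, 47, 38, 36, 28, 25, 20, 19,
     14, 13, 9, 8, 5, 5, 4, 2, 2, 1, 1, 1, 1]"
  by code_simp

lemma certificate_150_155:
  "certificate 150 155 37 681
    [1054, 1054, 1047, 1047, 1040, 1040, 1021, 1018, 999, 999, 975, 957, 936, 927, 907,
     884, 852, 849, 813, 790, 759, 749, 714, 694, 658, 645, 611, 590, 558, 543, 509, 494,
     460, 444, 417, 396, 368, 351, 319, 308, 280, 263, 239, 229, 206, 193, 172, 165, 147,
     136, 118, 114, 97, 88, 76, 71, 61, 54, 44, 42, 33, 28, 23, 20, 16, 13, 9, 8, 5, 4, 2,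
     2, 1, 1]"
  by code_simp

lemma certificate_155_160:
  "certificate 155 160 41 662
    [1000, 1000, 1000, 1000, 990, 990, 987, 974, 965, 953, 936, 921, 916, 886, 884, 852,
     841, 813, 810, 781, 746, 746, 709, 689, 659, 648, 611, 599, 572, 555, 528, 499, 492,
     456, 443, 411, 402, 372, 357, 332, 308, 293, 266, 257, 234, 223, 203, 190, 173, 168,
     152, 135, 126, 111, 101, 89, 85, 72, 66, 58, 48, 42, 34, 33, 25, 22, 16, 13, 10, 9,
     5, 4, 2, 1, 1]"
  by code_simp

lemma certificate_160_165:
  "certificate 160 165 34 645
    [300, 300, 300, 300, 295, 292, 288, 284, 280, 273, 268, 262, 252, 249, 237, 232, 225,
     215, 214, 197, 186, 184, 168, 167, 157, 143, 141, 129, 125, 113, 103, 99, 89, 87, 74,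
     66, 65, 56, 55, 49, 40, 39, 34, 29, 26, 22, 19, 16, 14, 11, 8, 7, 5, 4, 2, 1, 1]"
  by code_simp

lemma certificate_165_170:
  "certificate 165 170 36 628
    [1000, 1000, 1000, 997, 985, 962, 962, 949, 912, 906, 891, 878, 848, 814, 796, 783,
     756, 709, 709, 657, 625, 597, 575, 553, 527, 487, 474, 434, 407, 391, 353, 325, 313,
     285, 249, 238, 221, 194, 189, 163, 141, 130, 114, 100, 88, 76, 65, 52, 40, 36, 26,
     16, 15, 7, 3, 2]"
  by code_simp

lemma certificate_170_175:
  "certificate 170 175 34 612
    [302, 302, 298, 294, 294, 287, 285, 280, 272, 265, 260, 253, 244, 235, 230, 219, 210,
     203, 192, 181, 171, 166, 154, 141, 137, 125, 115, 110, 99, 90, 83, 79, 70, 63, 58,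
     52, 45, 41, 34, 29, 24, 22, 17, 12, 10, 7, 5, 3, 2]"
  by code_simp

lemma certificate_175_181:
  "certificate 175 181 35 595
    [387, 387, 375, 368, 365, 360, 357, 348, 341, 334, 327, 320, 307, 300, 283, 270, 254,
     254, 245, 230, 214, 205, 190, 174, 162, 153, 142, 129, 119, 114, 107, 97, 87, 80, 69,
     60, 50, 48, 41, 34, 26, 22, 18, 11, 8, 5, 3]"
  by code_simp

lemma certificate_181_188:
  "certificate 181 188 45 575
    [1000, 1000, 967, 952, 943, 928, 928, 916, 891, 873, 873, 873, 840, 823, 799, 770,
     750, 721, 698, 683, 650, 641, 641, 597, 574, 543, 501, 485, 451, 426, 392, 380, 366,
     348, 327, 304, 283, 279, 260, 237, 211, 186, 166, 160, 143, 124, 114, 92, 81, 70, 54,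
     40, 31, 24, 14, 7]"
  by code_simp

lemma certificate_188_193:
  "certificate 188 193 32 562
    [315, 315, 310, 303, 298, 291, 278, 276, 263, 262, 254, 233, 228, 220, 207, 192, 180,
     174, 158, 143, 130, 123, 117, 104, 98, 86, 81, 71, 58, 53, 44, 37, 26, 20, 17, 9, 5]"
  by code_simp

lemma certificate_193_200:
  "certificate 193 200 38 545
    [350, 350, 336, 334, 323, 319, 298, 298, 298, 290, 282, 256, 249, 249, 237, 234, 230,
     212, 207, 192, 180, 160, 149, 137, 137, 130, 115, 109, 106, 98, 89, 74, 63, 60, 50,
     45, 34, 28, 21, 13, 6]"
  by code_simp

section \<open>The lower bound for Garsia's entropy\<close>

lemma level_entropy_ge:
  assumes "1.41 \<le> \<gamma>" and "\<gamma> \<le> 2"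
  shows "7 / 8 * (real n * ln \<gamma>) \<le> level_entropy \<gamma> n"
proof -
  consider "\<gamma> \<le> 1.43" | "1.43 \<le> \<gamma>" "\<gamma> \<le> 1.46" | "1.46 \<le> \<gamma>" "\<gamma> \<le> 1.50" | "1.50 \<le> \<gamma>" "\<gamma> \<le> 1.55"
    | "1.55 \<le> \<gamma>" "\<gamma> \<le> 1.60" | "1.60 \<le> \<gamma>" "\<gamma> \<le> 1.65" | "1.65 \<le> \<gamma>" "\<gamma> \<le> 1.70"
    | "1.70 \<le> \<gamma>" "\<gamma> \<le> 1.75" | "1.75 \<le> \<gamma>" "\<gamma> \<le> 1.81" | "1.81 \<le> \<gamma>" "\<gamma> \<le> 1.88"
    | "1.88 \<le> \<gamma>" "\<gamma> \<le> 1.93" | "1.93 \<le> \<gamma>"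
    by linarith
  then show ?thesis
  proof cases
    case 1
    with assms show ?thesis by (intro level_entropy_ge_certificate[OF certificate_141_143]) simp_all
  next
    case 2
    with assms show ?thesis by (intro level_entropy_ge_certificate[OF certificate_143_146]) simp_all
  next
    case 3
    with assms show ?thesis by (intro level_entropy_ge_certificate[OF certificate_146_150]) simp_all
  next
    case 4
    with assms show ?thesis by (intro level_entropy_ge_certificate[OF certificate_150_155]) simp_all
  next
    case 5
    with assms show ?thesis by (intro level_entropy_ge_certificate[OF certificate_155_160]) simp_all
  next
    case 6
    with assms show ?thesis by (intro level_entropy_ge_certificate[OF certificate_160_165]) simp_all
  next
    case 7
    with assms show ?thesis by (intro level_entropy_ge_certificate[OF certificate_165_170]) simp_all
  next
    case 8
    with assms show ?thesis by (intro level_entropy_ge_certificate[OF certificate_170_175]) simp_all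
  next
    case 9
    with assms show ?thesis by (intro level_entropy_ge_certificate[OF certificate_175_181]) simp_all
  next
    case 10
    with assms show ?thesis by (intro level_entropy_ge_certificate[OF certificate_181_188]) simp_all
  next
    case 11
    with assms show ?thesis by (intro level_entropy_ge_certificate[OF certificate_188_193]) simp_all
  next
    case 12
    with assms show ?thesis by (intro level_entropy_ge_certificate[OF certificate_193_200]) simp_all
  qed
qed

text \<open>
  The window \<open>[1.41, 2]\<close> is long enough to be hit by the powers of every base: powers below 1.41
  of a base below 1.41 cannot jump over it, because \<open>1.41 * 1.41 < 2\<close>.
\<close>

lemma power_in_window:
  fixes \<beta> :: real
  assumes "1 < \<beta>" and "\<beta> < 2"
  obtains k where "1 \<le> k" and "1.41 \<le> \<beta> ^ k" and "\<beta> ^ k \<le> 2"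
proof -
  obtain m where m: "1.41 < \<beta> ^ m" using real_arch_pow[OF \<open>1 < \<beta>\<close>] by blast
  define k where "k = (LEAST k. 1.41 \<le> \<beta> ^ k)"
  have k: "1.41 \<le> \<beta> ^ k"
    unfolding k_def by (rule LeastI[of "\<lambda>k. 1.41 \<le> \<beta> ^ k" m]) (use m in simp)
  obtain j where j: "k = Suc j" using k by (cases k) auto
  have "\<beta> ^ j < 1.41" using not_less_Least[of j "\<lambda>k. 1.41 \<le> \<beta> ^ k"] j by (simp add: k_def)
  have "\<beta> ^ k \<le> 2"
  proof (cases "j = 0")
    case False
    then have "\<beta> \<le> \<beta> ^ j" using assms by (intro self_le_power) auto
    then have "\<beta> * \<beta> ^ j \<le> 1.41 * 1.41"
      using \<open>\<beta> ^ j < 1.41\<close> assms by (intro mult_mono) auto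
    then show ?thesis by (simp add: j)
  qed (use j assms in simp)
  with k j show thesis by (intro that[of k]) simp_all
qed

text \<open>
  Only the digits at multiples of \<open>k\<close> are used. The incomplete last block of length less than \<open>k\<close>
  costs the factor \<open>1 - k / n\<close>, which disappears in the limit.
\<close>

lemma garsia_entropy_ge:
  assumes \<beta>: "1 < \<beta>" "\<beta> < 2"
  shows "7 / 8 \<le> garsia_entropy \<beta>"
proof -
  obtain k where k: "1 \<le> k" "1.41 \<le> \<beta> ^ k" "\<beta> ^ k \<le> 2"
    using power_in_window[OF \<beta>] .
  have "7 / 8 * (1 - real k / real n) \<le> level_entropy \<beta> n / (real n * ln \<beta>)" if n: "1 \<le> n" for n
  proof -
    have "n \<le> n div k * k + k"
      using div_mult_mod_eq[of n k] mod_less_divisor[of k n] k(1) by linarith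
    then have "real n \<le> real (n div k * k + k)" by (simp only: of_nat_le_iff)
    then have "real n - real k \<le> real (n div k) * real k" by simp
    then have "7 / 8 * ((real n - real k) * ln \<beta>) \<le> 7 / 8 * (real (n div k) * real k * ln \<beta>)"
      using \<beta> by (intro mult_left_mono mult_right_mono) auto
    also have "\<dots> = 7 / 8 * (real (n div k) * ln (\<beta> ^ k))"
      using \<beta> by (simp add: ln_realpow)
    also have "\<dots> \<le> level_entropy \<beta> n"
      using level_entropy_ge[OF k(2,3), of "n div k"] level_entropy_power_le[OF \<beta>(1) k(1), of n] by linarith
    finally have "7 / 8 * ((real n - real k) * ln \<beta>) \<le> level_entropy \<beta> n" .
    then have "7 / 8 * ((real n - real k) * ln \<beta>) / (real n * ln \<beta>) \<le> level_entropy \<beta> n / (real n * ln \<beta>)"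
      using \<beta> by (intro divide_right_mono) auto
    also have "7 / 8 * ((real n - real k) * ln \<beta>) / (real n * ln \<beta>) = 7 / 8 * (1 - real k / real n)"
      using \<beta> n by (simp add: field_simps)
    finally show ?thesis .
  qed
  moreover have "(\<lambda>n. 7 / 8 * (1 - real k / real n)) \<longlonglongrightarrow> 7 / 8 * (1 - 0)"
    by (intro tendsto_intros lim_const_over_n)
  ultimately show ?thesis
    using LIMSEQ_le[OF _ garsia_entropy_limit[OF \<beta>(1)]] by fastforce
qed

theorem proposition10:
  fixes \<beta> :: real
  assumes "pisot \<beta>" and "\<beta> < 1.7"
  shows "garsia_entropy \<beta> > 0.87"
proof -
  have "7 / 8 \<le> garsia_entropy \<beta>"
    using assms by (intro garsia_entropy_ge) (auto simp: pisot_def)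
  then show ?thesis by simp
qed

end
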